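(* Let $(G,\phi)$ be a finite magnetic group with $G_0=\ker\phi$, and let $V,W$ be two irreducible representations of $(G,\phi)$. \begin{enumerate} \item If $T\in \operatorname{Hom}_{(G,\phi)}(V,W)$, then $T$ is zero or an isomorphism. \item If $V=W$ and we denote $V_0=\operatorname{Res}^G_{G_0}(V)$, then \[\operatorname{End}_{(G,\phi)}(V)\cong\begin{cases}\mathbb{R}, & \text{if } V_0 \text{ is irreducible},\\ \mathbb{C}, & \text{if } V_0 \text{ is not irreducible and } V_0\not\cong aV_0,\\ \mathbb{H}, & \text{if } V_0 \text{ is not irreducible and } V_0\cong aV_0.\end{cases}\] \end{enumerate} Here $a$ is a fixed element of $G\setminus G_0$ and $aV_0$ is the conjugate representation of $V_0$.
   Context: A magnetic group is a pair $(G,\phi)$ with $G$ a group and $\phi:G\to\mathbb{Z}/2$ a surjective homomorphism; $G_0=\ker\phi$. A map $A$ between complex vector spaces is antilinear if it is additive and $A(zv)=\overline{z}A(v)$ for $z\in\mathbb{C}$. A representation of $(G,\phi)$ on a finite-dimensional complex vector space $V$ is a homomorphism $\rho$ from $G$ to the group of invertible linear or antilinear maps $V\to V$ such that $\rho(g)$ is linear if $\phi(g)=0$ and antilinear if $\phi(g)=1$. A morphism of representations of $(G,\phi)$ is a $\mathbb{C}$-linear map $T$ commuting with the actions of all $g\in G$; the set of morphisms from $V$ to $W$ is $\operatorname{Hom}_{(G,\phi)}(V,W)$, and $\operatorname{End}_{(G,\phi)}(V)=\operatorname{Hom}_{(G,\phi)}(V,V)$. A representation $V$ is irreducible if its only subrepresentations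 (invariant complex subspaces) are $0$ and $V$. $\operatorname{Res}^G_{G_0}V$ is the ordinary complex representation of $G_0$ obtained by restriction; irreducibility of $V_0$ and the relation $V_0\cong aV_0$ are understood for representations of $G_0$. Conjugate representation: for an ordinary complex representation $\rho:G_0\to\operatorname{GL}(U)$ and a fixed $a\in G\setminus G_0$, let $aU=\{au\mid u\in U\}$ be the complex vector space of formal symbols with $au+aw=a(u+w)$ and $\lambda\cdot au=a(\overline{\lambda}u)$, with $G_0$-action $g\cdot(au)=a[\rho(a^{-1}ga)(u)]$. Up to isomorphism it does not depend on the choice of $a$. $\mathbb{H}$ denotes the quaternions.
   Formalization: Since V_0 ≅ aV_0 always holds, the stated criterion wrongly gives H whenever V_0 is reducible. The formal theorem instead compares U with aU, for every irreducible G_0-subrepresentation U of V_0: C if U ≇ aU, H if U ≅ aU. *)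

theory Defs
  imports Complex_Main "HOL-Algebra.Elementary_Groups"
begin

section \<open>Magnetic groups\<close>

locale magnetic_group = group G for G :: "('g, 'm) monoid_scheme" (structure) +
  fixes \<phi> :: "'g \<Rightarrow> int"
  assumes phi_epi: "\<phi> \<in> epi G (integer_mod_group 2)"

abbreviation even_part :: "('g, 'm) monoid_scheme \<Rightarrow> ('g \<Rightarrow> int) \<Rightarrow> 'g set" where
  "even_part G \<phi> \<equiv> kernel G (integer_mod_group 2) \<phi>"

section \<open>Finite-dimensional complex vector spaces and (anti)linear maps\<close>

text \<open>
  A complex vector space is a triple of an additive group type, a scalar multiplication \<open>s\<close> on it
  and a subspace \<open>V\<close> serving as carrier. Explicit carriers let subrepresentations be treated as
  representations in their own right. An explicit \<open>s\<close> lets the conjugate space use the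
  same underlying type.
\<close>

definition fd_cspace :: "(complex \<Rightarrow> 'v::ab_group_add \<Rightarrow> 'v) \<Rightarrow> 'v set \<Rightarrow> bool" where
  "fd_cspace s V \<longleftrightarrow> vector_space s \<and> (\<exists>B. finite B \<and> module.span s B = V)"

definition linear_map ::
  "(complex \<Rightarrow> 'v::ab_group_add \<Rightarrow> 'v) \<Rightarrow> 'v set \<Rightarrow> (complex \<Rightarrow> 'w::ab_group_add \<Rightarrow> 'w) \<Rightarrow> 'w set
    \<Rightarrow> ('v \<Rightarrow> 'w) \<Rightarrow> bool" where
  "linear_map s V t W A \<longleftrightarrow> A \<in> V \<rightarrow> W \<and>
     (\<forall>u\<in>V. \<forall>v\<in>V. A (u + v) = A u + A v) \<and> (\<forall>z. \<forall>v\<in>V. A (s z v) = t z (A v))"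

definition antilinear_map ::
  "(complex \<Rightarrow> 'v::ab_group_add \<Rightarrow> 'v) \<Rightarrow> 'v set \<Rightarrow> (complex \<Rightarrow> 'w::ab_group_add \<Rightarrow> 'w) \<Rightarrow> 'w set
    \<Rightarrow> ('v \<Rightarrow> 'w) \<Rightarrow> bool" where
  "antilinear_map s V t W A \<longleftrightarrow> A \<in> V \<rightarrow> W \<and>
     (\<forall>u\<in>V. \<forall>v\<in>V. A (u + v) = A u + A v) \<and> (\<forall>z. \<forall>v\<in>V. A (s z v) = t (cnj z) (A v))"

section \<open>Representations\<close>

definition magnetic_rep ::
  "('g, 'm) monoid_scheme \<Rightarrow> ('g \<Rightarrow> int) \<Rightarrow> (complex \<Rightarrow> 'v::ab_group_add \<Rightarrow> 'v) \<Rightarrow> 'v set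
    \<Rightarrow> ('g \<Rightarrow> 'v \<Rightarrow> 'v) \<Rightarrow> bool" where
  "magnetic_rep G \<phi> s V \<rho> \<longleftrightarrow> fd_cspace s V \<and>
     (\<forall>g\<in>carrier G. bij_betw (\<rho> g) V V) \<and>
     (\<forall>g\<in>carrier G. \<phi> g = 0 \<longrightarrow> linear_map s V s V (\<rho> g)) \<and>
     (\<forall>g\<in>carrier G. \<phi> g = 1 \<longrightarrow> antilinear_map s V s V (\<rho> g)) \<and>
     (\<forall>g\<in>carrier G. \<forall>h\<in>carrier G. \<forall>v\<in>V. \<rho> (g \<otimes>\<^bsub>G\<^esub> h) v = \<rho> g (\<rho> h v))"

text \<open>
  In the following notions \<open>H\<close> is the set of acting group elements: \<open>H = carrier G\<close> gives the
  notions for \<open>(G, \<phi>)\<close>-representations, and \<open>H = even_part G \<phi>\<close> those for the restrictions to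
  the kernel of \<open>\<phi>\<close>.
\<close>

definition subrep ::
  "'g set \<Rightarrow> (complex \<Rightarrow> 'v::ab_group_add \<Rightarrow> 'v) \<Rightarrow> 'v set \<Rightarrow> ('g \<Rightarrow> 'v \<Rightarrow> 'v) \<Rightarrow> 'v set \<Rightarrow> bool" where
  "subrep H s V \<rho> U \<longleftrightarrow> module.subspace s U \<and> U \<subseteq> V \<and> (\<forall>g\<in>H. \<forall>u\<in>U. \<rho> g u \<in> U)"

definition irreducible_rep ::
  "'g set \<Rightarrow> (complex \<Rightarrow> 'v::ab_group_add \<Rightarrow> 'v) \<Rightarrow> 'v set \<Rightarrow> ('g \<Rightarrow> 'v \<Rightarrow> 'v) \<Rightarrow> bool" where
  "irreducible_rep H s V \<rho> \<longleftrightarrow> V \<noteq> {0} \<and> (\<forall>U. subrep H s V \<rho> U \<longrightarrow> U = {0} \<or> U = V)"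

text \<open>Morphisms are taken extensional, so that equality of morphisms is equality on \<open>V\<close>.\<close>

definition Hom_rep ::
  "'g set \<Rightarrow> (complex \<Rightarrow> 'v::ab_group_add \<Rightarrow> 'v) \<Rightarrow> 'v set \<Rightarrow> ('g \<Rightarrow> 'v \<Rightarrow> 'v)
    \<Rightarrow> (complex \<Rightarrow> 'w::ab_group_add \<Rightarrow> 'w) \<Rightarrow> 'w set \<Rightarrow> ('g \<Rightarrow> 'w \<Rightarrow> 'w) \<Rightarrow> ('v \<Rightarrow> 'w) set" where
  "Hom_rep H s V \<rho> t W \<sigma> =
     {T \<in> extensional V. linear_map s V t W T \<and> (\<forall>g\<in>H. \<forall>v\<in>V. T (\<rho> g v) = \<sigma> g (T v))}"

definition is_iso_rep ::
  "'g set \<Rightarrow> (complex \<Rightarrow> 'v::ab_group_add \<Rightarrow> 'v) \<Rightarrow> 'v set \<Rightarrow> ('g \<Rightarrow> 'v \<Rightarrow> 'v)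
    \<Rightarrow> (complex \<Rightarrow> 'w::ab_group_add \<Rightarrow> 'w) \<Rightarrow> 'w set \<Rightarrow> ('g \<Rightarrow> 'w \<Rightarrow> 'w) \<Rightarrow> ('v \<Rightarrow> 'w) \<Rightarrow> bool" where
  "is_iso_rep H s V \<rho> t W \<sigma> T \<longleftrightarrow> T \<in> Hom_rep H s V \<rho> t W \<sigma> \<and>
     (\<exists>S\<in>Hom_rep H t W \<sigma> s V \<rho>. (\<forall>v\<in>V. S (T v) = v) \<and> (\<forall>w\<in>W. T (S w) = w))"

definition iso_rep ::
  "'g set \<Rightarrow> (complex \<Rightarrow> 'v::ab_group_add \<Rightarrow> 'v) \<Rightarrow> 'v set \<Rightarrow> ('g \<Rightarrow> 'v \<Rightarrow> 'v)
    \<Rightarrow> (complex \<Rightarrow> 'w::ab_group_add \<Rightarrow> 'w) \<Rightarrow> 'w set \<Rightarrow> ('g \<Rightarrow> 'w \<Rightarrow> 'w) \<Rightarrow> bool" where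
  "iso_rep H s V \<rho> t W \<sigma> \<longleftrightarrow> (\<exists>T. is_iso_rep H s V \<rho> t W \<sigma> T)"

section \<open>Conjugate representations\<close>

text \<open>
  The formal symbol \<open>a u\<close> is encoded by \<open>u\<close> itself: \<open>aU\<close> has the carrier and addition of \<open>U\<close>, the
  scalar multiplication \<open>conj_scale s\<close> and the action \<open>conj_act G a \<rho>\<close>.
\<close>

definition conj_scale :: "(complex \<Rightarrow> 'v \<Rightarrow> 'v) \<Rightarrow> complex \<Rightarrow> 'v \<Rightarrow> 'v" where
  "conj_scale s z u = s (cnj z) u"

definition conj_act :: "('g, 'm) monoid_scheme \<Rightarrow> 'g \<Rightarrow> ('g \<Rightarrow> 'v \<Rightarrow> 'v) \<Rightarrow> 'g \<Rightarrow> 'v \<Rightarrow> 'v" where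
  "conj_act G a \<rho> g u = \<rho> (inv\<^bsub>G\<^esub> a \<otimes>\<^bsub>G\<^esub> g \<otimes>\<^bsub>G\<^esub> a) u"

definition iso_to_conj ::
  "('g, 'm) monoid_scheme \<Rightarrow> ('g \<Rightarrow> int) \<Rightarrow> 'g \<Rightarrow> (complex \<Rightarrow> 'v::ab_group_add \<Rightarrow> 'v) \<Rightarrow> 'v set
    \<Rightarrow> ('g \<Rightarrow> 'v \<Rightarrow> 'v) \<Rightarrow> bool" where
  "iso_to_conj G \<phi> a s U \<rho> \<longleftrightarrow>
     iso_rep (even_part G \<phi>) s U \<rho> (conj_scale s) U (conj_act G a \<rho>)"

section \<open>The quaternions as a real algebra\<close>

datatype quat = Quat (qRe: real) (qI: real) (qJ: real) (qK: real)

instantiation quat :: real_algebra_1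
begin

definition zero_quat where "0 = Quat 0 0 0 0"
definition one_quat where "1 = Quat 1 0 0 0"
definition plus_quat where
  "x + y = Quat (qRe x + qRe y) (qI x + qI y) (qJ x + qJ y) (qK x + qK y)"
definition uminus_quat where "- x = Quat (- qRe x) (- qI x) (- qJ x) (- qK x)"
definition minus_quat where
  "x - y = Quat (qRe x - qRe y) (qI x - qI y) (qJ x - qJ y) (qK x - qK y)"
definition times_quat where
  "x * y = Quat
     (qRe x * qRe y - qI x * qI y - qJ x * qJ y - qK x * qK y)
     (qRe x * qI y + qI x * qRe y + qJ x * qK y - qK x * qJ y)
     (qRe x * qJ y - qI x * qK y + qJ x * qRe y + qK x * qI y)
     (qRe x * qK y + qI x * qJ y - qJ x * qI y + qK x * qRe y)"
definition scaleR_quat where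
  "scaleR r x = Quat (r * qRe x) (r * qI x) (r * qJ x) (r * qK x)"

instance
  by intro_classes
    (simp_all add: zero_quat_def one_quat_def plus_quat_def uminus_quat_def minus_quat_def
      times_quat_def scaleR_quat_def quat.expand algebra_simps)

end

section \<open>Endomorphism algebras\<close>

text \<open>
  Isomorphism, as unital real algebras, of \<open>'a\<close> with the algebra of endomorphisms of \<open>V\<close> under
  pointwise addition, composition and multiplication by real scalars. Antilinear operators do not
  commute with \<open>\<i>\<close>, so in general the endomorphisms only form a real algebra.
\<close>

definition End_isomorphic ::
  "'g set \<Rightarrow> (complex \<Rightarrow> 'v::ab_group_add \<Rightarrow> 'v) \<Rightarrow> 'v set \<Rightarrow> ('g \<Rightarrow> 'v \<Rightarrow> 'v)
    \<Rightarrow> 'a::real_algebra_1 itself \<Rightarrow> bool" where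
  "End_isomorphic H s V \<rho> (A :: 'a itself) \<longleftrightarrow>
     (\<exists>f :: 'a \<Rightarrow> 'v \<Rightarrow> 'v. bij_betw f UNIV (Hom_rep H s V \<rho> s V \<rho>) \<and>
        (\<forall>v\<in>V. f 1 v = v) \<and>
        (\<forall>x y. \<forall>v\<in>V. f (x + y) v = f x v + f y v) \<and>
        (\<forall>x y. \<forall>v\<in>V. f (x * y) v = f x (f y v)) \<and>
        (\<forall>r x. \<forall>v\<in>V. f (r *\<^sub>R x) v = s (complex_of_real r) (f x v)))"

section \<open>Irreducible constituents and the comparison with the conjugate\<close>

text \<open>
  The restriction of a \<open>(G, \<phi>)\<close>-representation is always isomorphic to its conjugate, via the action
  of \<open>a\<close>. The trichotomy for a reducible restriction is therefore governed by whether an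
  irreducible constituent \<open>U\<close> of it is isomorphic to \<open>aU\<close>.
\<close>

lemma (in magnetic_group) restriction_iso_conj:
  fixes s :: "complex \<Rightarrow> 'v::ab_group_add \<Rightarrow> 'v"
  assumes rep: "magnetic_rep G \<phi> s V \<rho>" and a: "a \<in> carrier G" "a \<notin> even_part G \<phi>"
  shows "iso_to_conj G \<phi> a s V \<rho>"
proof -
  have hom: "\<phi> \<in> hom G (integer_mod_group 2)" using phi_epi by (simp add: epi_def)
  have range: "\<phi> g = 0 \<or> \<phi> g = 1" if "g \<in> carrier G" for g
    using hom that by (auto simp: hom_def carrier_integer_mod_group Pi_iff)
  have pa: "\<phi> a = 1" using a range by (auto simp: kernel_def)
  interpret \<phi>: group_hom G "integer_mod_group 2" \<phi>
    by (simp add: group_hom_def group_hom_axioms_def hom)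
  have ia: "inv a \<in> carrier G" using a by simp
  have pia: "\<phi> (inv a) = 1"
    using \<phi>.hom_inv[OF a(1)] pa by (simp add: carrier_integer_mod_group)
  have al: "antilinear_map s V s V (\<rho> b)" if "b \<in> carrier G" "\<phi> b = 1" for b
    using rep that by (simp add: magnetic_rep_def)
  have mul: "\<rho> (g \<otimes> h) v = \<rho> g (\<rho> h v)" if "g \<in> carrier G" "h \<in> carrier G" "v \<in> V" for g h v
    using rep that by (simp add: magnetic_rep_def)
  have bij: "bij_betw (\<rho> g) V V" if "g \<in> carrier G" for g
    using rep that by (simp add: magnetic_rep_def)
  have inV: "\<rho> g v \<in> V" if "g \<in> carrier G" "v \<in> V" for g v
    using bij_betwE[OF bij] that by blast
  have one: "\<rho> \<one> v = v" if "v \<in> V" for v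
    using mul[of \<one> \<one> v] bij_betw_imp_inj_on[OF bij[of \<one>]] that inV[of \<one> v]
    by (simp add: inj_on_eq_iff)
  have canc: "\<rho> a (\<rho> (inv a) v) = v" "\<rho> (inv a) (\<rho> a v) = v" if "v \<in> V" for v
    using mul[of a "inv a" v] mul[of "inv a" a v] a ia that one by auto
  have vs: "vector_space s" using rep by (simp add: magnetic_rep_def fd_cspace_def)
  interpret vector_space s by (rule vs)
  have sub: "subspace V"
    using rep by (auto simp: magnetic_rep_def fd_cspace_def)
  have addV: "u + v \<in> V" and scV: "s z u \<in> V" if "u \<in> V" "v \<in> V" for u v z
    using sub that by (auto intro: subspace_add subspace_scale)
  have dm: "(\<And>u v. u \<in> V \<Longrightarrow> v \<in> V \<Longrightarrow> \<rho> b (u + v) = \<rho> b u + \<rho> b v)"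
      "(\<And>z v. v \<in> V \<Longrightarrow> \<rho> b (s z v) = s (cnj z) (\<rho> b v))" if "b \<in> {a, inv a}" for b
    using al[of b] that a ia pa pia by (auto simp: antilinear_map_def)
  have ca: "inv a \<otimes> g \<otimes> a \<in> carrier G" if "g \<in> carrier G" for g using that a by simp
  have cc: "a \<otimes> (inv a \<otimes> g \<otimes> a) = g \<otimes> a" if "g \<in> carrier G" for g
    using that a ia by (simp add: m_assoc[symmetric])
  have act1: "\<rho> (inv a) (\<rho> g v) = conj_act G a \<rho> g (\<rho> (inv a) v)"
    if "g \<in> carrier G" "v \<in> V" for g v
  proof -
    have "conj_act G a \<rho> g (\<rho> (inv a) v) = \<rho> (inv a \<otimes> g) (\<rho> a (\<rho> (inv a) v))"
      unfolding conj_act_def using that a ia by (subst mul[symmetric]) (auto intro: inV)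
    also have "\<dots> = \<rho> (inv a) (\<rho> g v)" using that ia canc by (simp add: mul)
    finally show ?thesis by simp
  qed
  have act2: "\<rho> a (conj_act G a \<rho> g v) = \<rho> g (\<rho> a v)" if "g \<in> carrier G" "v \<in> V" for g v
    unfolding conj_act_def using that a ia ca cc mul by metis
  have cin: "conj_act G a \<rho> g v \<in> V" if "g \<in> carrier G" "v \<in> V" for g v
    unfolding conj_act_def using that ca inV by blast
  have kc: "g \<in> carrier G" if "g \<in> even_part G \<phi>" for g using that by (simp add: kernel_def)
  have 1: "restrict (\<rho> (inv a)) V
      \<in> Hom_rep (even_part G \<phi>) s V \<rho> (conj_scale s) V (conj_act G a \<rho>)"
    unfolding Hom_rep_def linear_map_def using a ia inV addV scV dm act1 kc
    by (auto simp: conj_scale_def)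
  have 2: "restrict (\<rho> a) V
      \<in> Hom_rep (even_part G \<phi>) (conj_scale s) V (conj_act G a \<rho>) s V \<rho>"
    unfolding Hom_rep_def linear_map_def using a ia inV addV scV dm act2 cin kc
    by (auto simp: conj_scale_def)
  show ?thesis
    unfolding iso_to_conj_def iso_rep_def is_iso_rep_def
    using 1 2 canc inV a ia
    by (intro exI[of _ "restrict (\<rho> (inv a)) V"] conjI bexI[of _ "restrict (\<rho> a) V"]) auto
qed

lemma irreducible_subrep_exists:
  fixes s :: "complex \<Rightarrow> 'v::ab_group_add \<Rightarrow> 'v"
  assumes V: "fd_cspace s V" "V \<noteq> {0}" and inv: "\<forall>g\<in>H. \<forall>v\<in>V. \<rho> g v \<in> V"
  shows "\<exists>U. subrep H s V \<rho> U \<and> irreducible_rep H s U \<rho>"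
proof -
  interpret vector_space s using V by (simp add: fd_cspace_def)
  obtain B where B: "finite B" "span B = V" using V by (auto simp: fd_cspace_def)
  have bound: "finite C \<and> card C \<le> card B" if "independent C" "C \<subseteq> V" for C
    using independent_span_bound[OF B(1) that(1)] that(2) B(2) by simp
  have less: "dim U < dim U'" if U: "subspace U" "subspace U'" "U \<subset> U'" "U' \<subseteq> V" for U U'
  proof -
    obtain C where C: "C \<subseteq> U" "independent C" "U \<subseteq> span C" "card C = dim U"
      using basis_exists by blast
    obtain D where D: "C \<subseteq> D" "D \<subseteq> U'" "independent D" "U' \<subseteq> span D"
      using maximal_independent_subset_extend[of C U'] C U by blast
    have "C \<noteq> D" using span_minimal[OF C(1) U(1)] U D by blast
    then have "card C < card D" using D bound[of D] U by (meson psubsetI psubset_card_mono order_trans)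
    then show ?thesis using C basis_card_eq_dim[OF D(2,4,3)] by simp
  qed
  have "subrep H s V \<rho> V \<and> V \<noteq> {0}" using V inv B by (auto simp: subrep_def)
  then obtain U where U: "subrep H s V \<rho> U" "U \<noteq> {0}"
    and min: "\<And>U'. subrep H s V \<rho> U' \<Longrightarrow> U' \<noteq> {0} \<Longrightarrow> dim U \<le> dim U'"
    using ex_has_least_nat[of "\<lambda>U. subrep H s V \<rho> U \<and> U \<noteq> {0}" V dim] by blast
  have "U' = {0} \<or> U' = U" if "subrep H s U \<rho> U'" for U'
  proof (rule ccontr)
    assume n: "\<not> ?thesis"
    have "subrep H s V \<rho> U'" using that U(1) by (auto simp: subrep_def)
    with n min have "dim U \<le> dim U'" by blast
    moreover have "dim U' < dim U" using that U(1) n by (intro less) (auto simp: subrep_def)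
    ultimately show False by simp
  qed
  with U show ?thesis by (auto simp: irreducible_rep_def)
qed

end

theory Submission
  imports Defs "HOL-Computational_Algebra.Fundamental_Theorem_Algebra"
begin

text \<open>
  Kernels and images of morphisms are subrepresentations, which gives Schur's dichotomy
  (\<open>schur_zero_or_iso\<close>) for antilinear as well as for linear actions. Over \<open>G\<^sub>0\<close>, where everything is
  complex linear, an endomorphism of an irreducible representation has an eigenvalue and is
  therefore a scalar (\<open>schur_scalar\<close>).

  If \<open>V\<^sub>0\<close> is irreducible, an endomorphism of \<open>V\<close> is a scalar that commutes with the antilinear
  operator \<open>\<rho> a\<close>, so it is real (\<open>End_irreducible_restriction\<close>).

  Otherwise let \<open>U\<close> be an irreducible constituent of \<open>V\<^sub>0\<close>. As \<open>a\<^sup>2\<close> lies in \<open>G\<^sub>0\<close>, both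
  \<open>U \<inter> \<rho> a U\<close> and \<open>U + \<rho> a U\<close> are stable under \<open>G\<close>, whence \<open>V = U \<oplus> \<rho> a U\<close>; here \<open>\<rho> a U\<close> is a copy
  of the conjugate \<open>aU\<close>. Commuting with \<open>\<rho> a\<close> means that an endomorphism is the same as a
  \<open>G\<^sub>0\<close>-morphism \<open>U \<rightarrow> U \<oplus> \<rho> a U\<close> (\<open>extend_End\<close>, \<open>End_eq_extend\<close>). Its first component is a complex
  scalar. Its second component vanishes if \<open>U\<close> and \<open>aU\<close> are not isomorphic, leaving \<open>\<complex>\<close>
  (\<open>End_complex\<close>). If \<open>f : U \<rightarrow> aU\<close> is an isomorphism, the second component is a complex multiple
  of \<open>\<rho> a \<circ> f\<close>, so \<open>\<rho> a \<circ> f\<close> induces an endomorphism \<open>J\<close> that anticommutes with the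
  endomorphism induced by \<open>\<i>\<close>. Its square is a real scalar, which cannot be a square in \<open>\<real>\<close>
  because endomorphisms have no zero divisors. After rescaling \<open>J\<^sup>2 = - 1\<close>
  (\<open>conj_hom_normalised\<close>), and the endomorphisms are the quaternions (\<open>End_quaternion\<close>).
\<close>

section \<open>Schur's lemma\<close>

lemma linear_mapD:
  assumes "linear_map s V t W T"
  shows "v \<in> V \<Longrightarrow> T v \<in> W"
    and "u \<in> V \<Longrightarrow> v \<in> V \<Longrightarrow> T (u + v) = T u + T v"
    and "v \<in> V \<Longrightarrow> T (s z v) = t z (T v)"
  using assms by (auto simp: linear_map_def)

text \<open>
  Kernel and image are subrepresentations as soon as group elements map \<open>0\<close> to \<open>0\<close>. This form
  covers antilinear actions as well as conjugate representations.
\<close>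
lemma schur_zero_or_iso:
  assumes s: "vector_space s" and t: "vector_space t"
    and V: "module.subspace s V" and W: "module.subspace t W"
    and \<rho>: "\<And>g v. g \<in> H \<Longrightarrow> v \<in> V \<Longrightarrow> \<rho> g v \<in> V"
    and \<sigma>0: "\<And>g. g \<in> H \<Longrightarrow> \<sigma> g 0 = 0"
    and irrV: "irreducible_rep H s V \<rho>" and irrW: "irreducible_rep H t W \<sigma>"
    and T: "T \<in> Hom_rep H s V \<rho> t W \<sigma>"
  shows "(\<forall>v\<in>V. T v = 0) \<or> is_iso_rep H s V \<rho> t W \<sigma> T"
proof (cases "\<forall>v\<in>V. T v = 0")
  case False
  interpret s: vector_space s by (rule s)
  interpret t: vector_space t by (rule t)
  have lin: "linear_map s V t W T" and eqv: "\<And>g v. g \<in> H \<Longrightarrow> v \<in> V \<Longrightarrow> T (\<rho> g v) = \<sigma> g (T v)"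
    using T by (auto simp: Hom_rep_def)
  note L = linear_mapD[OF lin]
  note sV = s.subspace_0[OF V] s.subspace_add[OF V] s.subspace_scale[OF V]
  have T0: "T 0 = 0" using L(3)[of 0 0] sV by simp
  have "subrep H s V \<rho> {v \<in> V. T v = 0}"
    unfolding subrep_def s.subspace_def using sV L \<rho> eqv \<sigma>0 T0 by auto
  then have ker: "{v \<in> V. T v = 0} = {0}" using irrV False by (auto simp: irreducible_rep_def)
  have "t.subspace (T ` V)"
    unfolding t.subspace_def
  proof (intro conjI ballI allI)
    show "0 \<in> T ` V" using T0 sV by force
    show "x + y \<in> T ` V" if "x \<in> T ` V" "y \<in> T ` V" for x y
      using that L(2) sV(2) by (auto simp flip: L(2))
    show "t c x \<in> T ` V" if "x \<in> T ` V" for c x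
      using that sV(3) by (auto simp flip: L(3))
  qed
  then have "subrep H t W \<sigma> (T ` V)"
    unfolding subrep_def using L \<rho> by (auto simp flip: eqv)
  moreover have "T ` V \<noteq> {0}" using False by auto
  ultimately have surj: "T ` V = W" using irrW by (auto simp: irreducible_rep_def)
  have inj: "inj_on T V"
  proof (rule inj_onI)
    fix u v assume uv: "u \<in> V" "v \<in> V" "T u = T v"
    have "T (u + s (-1) v) = T u + t (-1) (T v)"
      using L(2)[of u "s (-1) v"] L(3)[of v "-1"] uv sV(3)[of v "-1"] by simp
    then have "u + s (-1) v \<in> {v \<in> V. T v = 0}"
      using uv sV(2)[of u "s (-1) v"] sV(3)[of v "-1"] by simp
    then show "u = v" unfolding ker by simp
  qed
  define S where "S = restrict (inv_into V T) W"
  have ST: "S (T v) = v" if "v \<in> V" for v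
    using that inj surj by (auto simp: S_def)
  have TS: "T (S w) = w" "S w \<in> V" if "w \<in> W" for w
    using that surj by (auto simp: S_def f_inv_into_f inv_into_into)
  have linS: "linear_map t W s V S"
    unfolding linear_map_def
  proof (intro conjI ballI allI)
    show "S \<in> W \<rightarrow> V" using TS by blast
    show "S (x + y) = S x + S y" if "x \<in> W" "y \<in> W" for x y
      using ST[of "S x + S y"] that TS L(2) sV by simp
    show "S (t z x) = s z (S x)" if "x \<in> W" for z x
      using ST[of "s z (S x)"] that TS L(3) sV by simp
  qed
  have "S (\<sigma> g w) = \<rho> g (S w)" if "g \<in> H" "w \<in> W" for g w
    using ST[of "\<rho> g (S w)"] that TS \<rho> eqv by simp
  then have "S \<in> Hom_rep H t W \<sigma> s V \<rho>"
    using linS by (auto simp: Hom_rep_def S_def)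
  then show ?thesis using T ST TS unfolding is_iso_rep_def by blast
qed simp

text \<open>
  The vectors \<open>v, T v, T\<^sup>2 v, \<dots>\<close> cannot all be independent, so some non-zero polynomial in \<open>T\<close>
  kills \<open>v\<close>. Splitting off one linear factor at a time (fundamental theorem of algebra), the last
  non-zero vector before \<open>v\<close> is killed is an eigenvector. Polynomials are applied to \<open>T\<close> by
  Horner's scheme.
\<close>
lemma eigenvector_exists:
  assumes s: "vector_space s"
    and B: "finite B" "U \<subseteq> module.span s B" and U: "module.subspace s U" "U \<noteq> {0}"
    and T: "linear_map s U s U T"
  shows "\<exists>z. \<exists>w\<in>U. w \<noteq> 0 \<and> T w = s z w"
proof -
  interpret s: vector_space s by (rule s)
  note L = linear_mapD[OF T]
  note sU = s.subspace_0[OF U(1)] s.subspace_add[OF U(1)] s.subspace_scale[OF U(1)]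
  have T0: "T 0 = 0" using L(3)[of 0 0] sU by simp
  obtain v where v: "v \<in> U" "v \<noteq> 0" using U(2) sU(1) by blast
  define ev where "ev p = fold_coeffs (\<lambda>c w. s c v + T w) p 0" for p
  have ev0 [simp]: "ev 0 = 0" by (simp add: ev_def)
  have ev_pCons: "ev (pCons c p) = s c v + T (ev p)" for c p
    by (cases "c = 0 \<and> p = 0") (auto simp: ev_def T0)
  have ev_in: "ev p \<in> U" for p
    by (induction p) (auto simp: ev_pCons sU L v)
  have ev_add: "ev (p + q) = ev p + ev q" for p q
    by (induction p q rule: poly_induct2)
      (auto simp: ev_pCons L ev_in s.scale_left_distrib algebra_simps)
  have ev_smult: "ev (smult c p) = s c (ev p)" for c p
    by (induction p) (auto simp: ev_pCons L ev_in s.scale_right_distrib)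
  have iter_in: "(T ^^ i) v \<in> U" for i by (induction i) (auto simp: v L)
  have ev_monom: "ev (monom c i) = s c ((T ^^ i) v)" for c i
    by (induction i) (auto simp: ev_pCons monom_0 monom_Suc T0 L iter_in)
  have ev_sum: "ev (sum f A) = (\<Sum>i\<in>A. ev (f i))" for f and A :: "nat set"
    by (induction A rule: infinite_finite_induct) (auto simp: ev_add)
  have "\<exists>p. p \<noteq> 0 \<and> ev p = 0"
  proof (cases "inj_on (\<lambda>i. (T ^^ i) v) {..card B}")
    case False
    then obtain i j where ij: "i \<noteq> j" "(T ^^ i) v = (T ^^ j) v" by (auto simp: inj_on_def)
    have "coeff (monom 1 i + monom (- 1) j) i = (1::complex)" using ij by simp
    then have "monom 1 i + monom (- 1) j \<noteq> (0 :: complex poly)" by (metis coeff_0 zero_neq_one)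
    moreover have "ev (monom 1 i + monom (- 1) j) = 0"
      using ij by (simp add: ev_add ev_monom)
    ultimately show ?thesis by blast
  next
    case True
    let ?S = "(\<lambda>i. (T ^^ i) v) ` {..card B}"
    have "s.dependent ?S"
    proof (rule ccontr)
      assume "s.independent ?S"
      then have "card ?S \<le> card B"
        using s.independent_span_bound[OF B(1)] iter_in B(2) by blast
      then show False using card_image[OF True] by simp
    qed
    then obtain c x where c: "x \<in> ?S" "c x \<noteq> 0" "(\<Sum>x\<in>?S. s (c x) x) = 0"
      by (subst (asm) s.dependent_finite) auto
    then obtain k where k: "k \<le> card B" "c ((T ^^ k) v) \<noteq> 0" by auto
    define p where "p = (\<Sum>i\<le>card B. monom (c ((T ^^ i) v)) i)"
    have "coeff p k \<noteq> 0" using k by (simp add: p_def coeff_sum)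
    then have "p \<noteq> 0" by auto
    moreover have "ev p = 0"
      using c(3) by (simp add: p_def ev_sum ev_monom sum.reindex[OF True])
    ultimately show ?thesis by blast
  qed
  then obtain p where p: "p \<noteq> 0" "ev p = 0" by blast
  then show ?thesis
  proof (induction "degree p" arbitrary: p rule: less_induct)
    case less
    show ?case
    proof (cases "degree p = 0")
      case True
      then obtain c where "p = [:c:]" by (meson degree_eq_zeroE)
      then show ?thesis using less.prems v by (simp add: ev_pCons T0)
    next
      case False
      then have "\<not> constant (poly p)" by (simp add: constant_degree)
      then obtain z where "poly p z = 0" using fundamental_theorem_of_algebra by blast
      then obtain q where q: "p = [:- z, 1:] * q" by (auto simp: poly_eq_0_iff_dvd)
      have q0: "q \<noteq> 0" using q less.prems by auto
      have "degree p = Suc (degree q)"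
        unfolding q using q0 by (subst degree_mult_eq) auto
      moreover have "T (ev q) = s z (ev q)"
      proof -
        have "ev p = ev (pCons 0 q) + ev (smult (- z) q)"
          unfolding q by (subst ev_add[symmetric]) simp
        then show ?thesis using less.prems(2) by (simp only: ev_smult ev_pCons) simp
      qed
      ultimately show ?thesis using less.hyps[of q] q0 ev_in by (cases "ev q = 0") auto
    qed
  qed
qed

text \<open>An eigenspace of an equivariant map is a subrepresentation if the group acts linearly.\<close>
lemma schur_scalar:
  assumes s: "vector_space s"
    and B: "finite B" "U \<subseteq> module.span s B" and U: "module.subspace s U"
    and irr: "irreducible_rep H s U \<rho>"
    and \<rho>: "\<And>g. g \<in> H \<Longrightarrow> linear_map s U s U (\<rho> g)"
    and T: "linear_map s U s U T"
    and eqv: "\<And>g u. g \<in> H \<Longrightarrow> u \<in> U \<Longrightarrow> T (\<rho> g u) = \<rho> g (T u)"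
  shows "\<exists>z. \<forall>u\<in>U. T u = s z u"
proof -
  interpret s: vector_space s by (rule s)
  note L = linear_mapD[OF T]
  note R = linear_mapD[OF \<rho>]
  note sU = s.subspace_0[OF U] s.subspace_add[OF U] s.subspace_scale[OF U]
  have T0: "T 0 = 0" using L(3)[of 0 0] sU by simp
  have "U \<noteq> {0}" using irr by (simp add: irreducible_rep_def)
  then obtain z w where w: "w \<in> U" "w \<noteq> 0" "T w = s z w"
    using eigenvector_exists[OF s B U _ T] by blast
  have "subrep H s U \<rho> {u \<in> U. T u = s z u}"
    unfolding subrep_def s.subspace_def
    using sU L R eqv T0 by (auto simp: s.scale_right_distrib mult.commute)
  then have "{u \<in> U. T u = s z u} = U" using irr w by (auto simp: irreducible_rep_def)
  then show ?thesis by blast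
qed

section \<open>The restriction to the even part\<close>

locale magnetic_rep_space = magnetic_group G \<phi> + vector_space s
  for G :: "('g, 'm) monoid_scheme" (structure) and \<phi> :: "'g \<Rightarrow> int"
    and s :: "complex \<Rightarrow> 'v::ab_group_add \<Rightarrow> 'v" +
  fixes V :: "'v set" and \<rho> :: "'g \<Rightarrow> 'v \<Rightarrow> 'v" and a :: 'g
  assumes rep: "magnetic_rep G \<phi> s V \<rho>"
    and a_in [simp]: "a \<in> carrier G" and a_odd: "a \<notin> even_part G \<phi>"
begin

lemma phi_hom: "group_hom G (integer_mod_group 2) \<phi>"
  using phi_epi by (simp add: group_hom_def group_hom_axioms_def epi_def)

lemma phi_range: "g \<in> carrier G \<Longrightarrow> \<phi> g = 0 \<or> \<phi> g = 1"
  using phi_epi by (auto simp: epi_def hom_def carrier_integer_mod_group Pi_iff)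

lemma phi_mult: "g \<in> carrier G \<Longrightarrow> h \<in> carrier G \<Longrightarrow> \<phi> (g \<otimes> h) = (\<phi> g + \<phi> h) mod 2"
  using group_hom.hom_mult[OF phi_hom, of g h] by simp

lemma even_iff: "g \<in> even_part G \<phi> \<longleftrightarrow> g \<in> carrier G \<and> \<phi> g = 0"
  by (auto simp: kernel_def)

lemma phi_a: "\<phi> a = 1"
  using phi_range[of a] a_odd by (auto simp: even_iff)

lemma phi_inv_a: "\<phi> (inv a) = 1"
  using group_hom.hom_inv[OF phi_hom a_in] phi_a by (simp add: carrier_integer_mod_group)

lemma even_carrier: "g \<in> even_part G \<phi> \<Longrightarrow> g \<in> carrier G"
  by (simp add: even_iff)

lemma square_even [simp]: "a \<otimes> a \<in> even_part G \<phi>"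
  by (simp add: even_iff phi_mult phi_a)

lemma conj_even:
  assumes "g \<in> even_part G \<phi>"
  shows "inv a \<otimes> g \<otimes> a \<in> even_part G \<phi>" "a \<otimes> g \<otimes> inv a \<in> even_part G \<phi>"
  using assms by (simp_all add: even_iff phi_mult phi_a phi_inv_a)

lemma odd_factor:
  assumes "g \<in> carrier G" "g \<notin> even_part G \<phi>"
  shows "inv a \<otimes> g \<in> even_part G \<phi>" "g = a \<otimes> (inv a \<otimes> g)"
  using assms phi_range[of g]
  by (auto simp: even_iff phi_mult phi_inv_a m_assoc[symmetric])

lemma subspace_V: "subspace V"
  using rep by (auto simp: magnetic_rep_def fd_cspace_def)

lemma finite_span: "\<exists>B. finite B \<and> span B = V"
  using rep by (auto simp: magnetic_rep_def fd_cspace_def)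

lemmas V_simps [simp] = subspace_0[OF subspace_V] subspace_add[OF subspace_V]
  subspace_scale[OF subspace_V]

lemma act_in [simp]: "g \<in> carrier G \<Longrightarrow> v \<in> V \<Longrightarrow> \<rho> g v \<in> V"
  using rep bij_betwE by (fastforce simp: magnetic_rep_def)

lemma act_mult: "g \<in> carrier G \<Longrightarrow> h \<in> carrier G \<Longrightarrow> v \<in> V \<Longrightarrow> \<rho> (g \<otimes> h) v = \<rho> g (\<rho> h v)"
  using rep by (simp add: magnetic_rep_def)

lemma act_inj: "g \<in> carrier G \<Longrightarrow> u \<in> V \<Longrightarrow> v \<in> V \<Longrightarrow> \<rho> g u = \<rho> g v \<Longrightarrow> u = v"
  using rep by (auto simp: magnetic_rep_def bij_betw_def inj_on_def)

lemma act_add: "g \<in> carrier G \<Longrightarrow> u \<in> V \<Longrightarrow> v \<in> V \<Longrightarrow> \<rho> g (u + v) = \<rho> g u + \<rho> g v"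
  using rep phi_range[of g] by (auto simp: magnetic_rep_def linear_map_def antilinear_map_def)

lemma act_zero [simp]: "g \<in> carrier G \<Longrightarrow> \<rho> g 0 = 0"
  using act_add[of g 0 0] by simp

lemma act_scale_even: "g \<in> even_part G \<phi> \<Longrightarrow> v \<in> V \<Longrightarrow> \<rho> g (s z v) = s z (\<rho> g v)"
  using rep by (auto simp: magnetic_rep_def linear_map_def even_iff)

lemma act_scale_a: "v \<in> V \<Longrightarrow> \<rho> a (s z v) = s (cnj z) (\<rho> a v)"
  using rep phi_a by (auto simp: magnetic_rep_def antilinear_map_def)

lemma cancel_a [simp]:
  assumes "g \<in> carrier G"
  shows "a \<otimes> (inv a \<otimes> g) = g" "inv a \<otimes> (a \<otimes> g) = g"
  using assms by (simp_all add: m_assoc[symmetric])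

lemma act_shift: "g \<in> even_part G \<phi> \<Longrightarrow> v \<in> V \<Longrightarrow> \<rho> g (\<rho> a v) = \<rho> a (\<rho> (inv a \<otimes> g \<otimes> a) v)"
  by (simp add: act_mult[symmetric] even_carrier m_assoc[symmetric])

text \<open>
  Since \<open>G = G\<^sub>0 \<union> a G\<^sub>0\<close>, stability and equivariance need to be checked on \<open>G\<^sub>0\<close> and on \<open>a\<close> only.
\<close>
lemma invariant_from_even:
  assumes U: "U \<subseteq> V" and even: "\<And>g u. g \<in> even_part G \<phi> \<Longrightarrow> u \<in> U \<Longrightarrow> \<rho> g u \<in> U"
    and odd: "\<And>u. u \<in> U \<Longrightarrow> \<rho> a u \<in> U" and g: "g \<in> carrier G" "u \<in> U"
  shows "\<rho> g u \<in> U"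
proof (cases "g \<in> even_part G \<phi>")
  case False
  have "\<rho> g u = \<rho> a (\<rho> (inv a \<otimes> g) u)"
    using odd_factor(2)[OF g(1) False] g U by (subst act_mult[symmetric]) auto
  then show ?thesis using even odd odd_factor(1)[OF g(1) False] g by simp
qed (use assms in auto)

lemma equivariant_from_even:
  assumes T: "\<And>v. v \<in> V \<Longrightarrow> T v \<in> V"
    and even: "\<And>g v. g \<in> even_part G \<phi> \<Longrightarrow> v \<in> V \<Longrightarrow> T (\<rho> g v) = \<rho> g (T v)"
    and odd: "\<And>v. v \<in> V \<Longrightarrow> T (\<rho> a v) = \<rho> a (T v)" and g: "g \<in> carrier G" "v \<in> V"
  shows "T (\<rho> g v) = \<rho> g (T v)"
proof (cases "g \<in> even_part G \<phi>")
  case False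
  have *: "\<rho> g w = \<rho> a (\<rho> (inv a \<otimes> g) w)" if "w \<in> V" for w
    using odd_factor(2)[OF g(1) False] g that by (subst act_mult[symmetric]) auto
  then show ?thesis using even odd odd_factor(1)[OF g(1) False] g T by simp
qed (use assms in auto)

text \<open>
  By Schur's lemma over \<open>G\<^sub>0\<close> an endomorphism is a scalar \<open>z\<close>; commuting with the antilinear \<open>\<rho> a\<close>
  forces \<open>z = cnj z\<close>.
\<close>
lemma End_irreducible_restriction:
  assumes irr: "irreducible_rep (even_part G \<phi>) s V \<rho>"
  shows "End_isomorphic (carrier G) s V \<rho> TYPE(real)"
proof -
  define f where "f r = restrict (s (complex_of_real r)) V" for r
  obtain B where B: "finite B" "V \<subseteq> span B" using finite_span by auto
  obtain v where v: "v \<in> V" "v \<noteq> 0"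
    using irr V_simps(1) unfolding irreducible_rep_def by blast
  have f_hom: "f r \<in> Hom_rep (carrier G) s V \<rho> s V \<rho>" for r
  proof -
    have "s (of_real r) (\<rho> g v) = \<rho> g (s (of_real r) v)" if "g \<in> carrier G" "v \<in> V" for g v
      by (rule equivariant_from_even[OF _ _ _ that, of "s (of_real r)"])
        (auto simp: act_scale_even act_scale_a)
    then show ?thesis
      unfolding Hom_rep_def linear_map_def f_def
      by (auto simp: scale_right_distrib mult.commute)
  qed
  have f_onto: "T \<in> range f" if T: "T \<in> Hom_rep (carrier G) s V \<rho> s V \<rho>" for T
  proof -
    have lin: "linear_map s V s V T" and ext: "T \<in> extensional V"
      and eqv: "\<And>g v. g \<in> carrier G \<Longrightarrow> v \<in> V \<Longrightarrow> T (\<rho> g v) = \<rho> g (T v)"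
      using T by (auto simp: Hom_rep_def)
    have "\<exists>z. \<forall>v\<in>V. T v = s z v"
    proof (rule schur_scalar[OF vector_space_axioms B subspace_V irr _ lin])
      show "linear_map s V s V (\<rho> g)" if "g \<in> even_part G \<phi>" for g
        using that by (auto simp: linear_map_def act_add act_scale_even even_carrier)
    qed (use eqv even_carrier in blast)
    then obtain z where z: "\<And>v. v \<in> V \<Longrightarrow> T v = s z v" by blast
    have "s z (\<rho> a v) = s (cnj z) (\<rho> a v)"
      using eqv[of a v] v z by (simp add: act_scale_a)
    moreover have "\<rho> a v \<noteq> 0" using act_inj[of a v 0] v by auto
    ultimately have "z = cnj z" by simp
    then obtain r where "z = of_real r" by (metis Reals_cnj_iff Reals_cases)
    then have "T = f r" using z ext by (auto simp: f_def extensional_def)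
    then show ?thesis by simp
  qed
  have "inj f"
    by (rule injI) (use v in \<open>metis f_def restrict_apply' scale_right_imp_eq of_real_eq_iff\<close>)
  then have "bij_betw f UNIV (Hom_rep (carrier G) s V \<rho> s V \<rho>)"
    using f_hom f_onto unfolding bij_betw_def by blast
  then show ?thesis
    unfolding End_isomorphic_def
    by (intro exI[of _ f]) (auto simp: f_def scale_left_distrib)
qed

end

section \<open>Reducible restriction: reduction to an irreducible constituent\<close>

locale split_magnetic_rep = magnetic_rep_space G \<phi> s V \<rho> a
  for G :: "('g, 'm) monoid_scheme" (structure) and \<phi> s
    and V :: "'v::ab_group_add set" and \<rho> a +
  fixes U :: "'v set"
  assumes irrV: "irreducible_rep (carrier G) s V \<rho>"
    and reducible: "\<not> irreducible_rep (even_part G \<phi>) s V \<rho>"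
    and U: "subrep (even_part G \<phi>) s V \<rho> U"
    and irrU: "irreducible_rep (even_part G \<phi>) s U \<rho>"
begin

lemma subspace_U: "subspace U" and U_V [simp]: "u \<in> U \<Longrightarrow> u \<in> V"
  and act_U [simp]: "g \<in> even_part G \<phi> \<Longrightarrow> u \<in> U \<Longrightarrow> \<rho> g u \<in> U"
  using U by (auto simp: subrep_def)

lemmas U_simps [simp] = subspace_0[OF subspace_U] subspace_add[OF subspace_U]
  subspace_scale[OF subspace_U]

lemma square_act [simp]: "v \<in> V \<Longrightarrow> \<rho> a (\<rho> a v) = \<rho> (a \<otimes> a) v"
  by (simp add: act_mult)

lemma subrep_all_trivial:
  assumes "subspace S" "S \<subseteq> V" "\<And>g u. g \<in> even_part G \<phi> \<Longrightarrow> u \<in> S \<Longrightarrow> \<rho> g u \<in> S"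
    "\<And>u. u \<in> S \<Longrightarrow> \<rho> a u \<in> S"
  shows "S = {0} \<or> S = V"
proof -
  have "subrep (carrier G) s V \<rho> S"
    using assms invariant_from_even[of S] by (auto simp: subrep_def)
  then show ?thesis using irrV by (auto simp: irreducible_rep_def)
qed

text \<open>\<open>U \<inter> \<rho> a U\<close> is stable under all of \<open>G\<close> and differs from \<open>V\<close>, hence is zero.\<close>
lemma meet_trivial:
  assumes "u \<in> U" "w \<in> U" "u = \<rho> a w"
  shows "u = 0" "w = 0"
proof -
  let ?S = "U \<inter> \<rho> a ` U"
  have "?S = {0} \<or> ?S = V"
  proof (rule subrep_all_trivial)
    show "subspace ?S"
      unfolding subspace_def
    proof (intro conjI ballI allI)
      show "0 \<in> ?S" by (auto intro!: image_eqI[of _ _ 0])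
      show "x + y \<in> ?S" if "x \<in> ?S" "y \<in> ?S" for x y
        using that by (auto simp: act_add[symmetric])
      show "s c x \<in> ?S" if x: "x \<in> ?S" for c x
      proof -
        obtain y where y: "y \<in> U" "x = \<rho> a y" using x by blast
        then have "s c x = \<rho> a (s (cnj c) y)" by (simp add: act_scale_a)
        moreover have "s c x \<in> U" "s (cnj c) y \<in> U" using x y by simp_all
        ultimately show ?thesis by blast
      qed
    qed
    show "\<rho> g x \<in> ?S" if "g \<in> even_part G \<phi>" "x \<in> ?S" for g x
      using that by (auto simp: act_shift conj_even)
    show "\<rho> a x \<in> ?S" if "x \<in> ?S" for x
      using that by auto
  qed auto
  moreover have "?S \<noteq> V"
  proof
    assume "?S = V"
    then have "U = V" using U by (auto simp: subrep_def)
    then show False using irrU reducible by simp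
  qed
  ultimately have "?S = {0}" by blast
  then show *: "u = 0" using assms by blast
  show "w = 0" using act_inj[of a w 0] * assms by simp
qed

text \<open>\<open>U + \<rho> a U\<close> is stable under \<open>\<rho> a\<close> since \<open>a\<^sup>2\<close> is even, hence is all of \<open>V\<close>.\<close>
lemma decomp_exists:
  assumes "v \<in> V"
  shows "\<exists>x\<in>U. \<exists>y\<in>U. v = x + \<rho> a y"
proof -
  let ?S = "{x + \<rho> a y | x y. x \<in> U \<and> y \<in> U}"
  have "?S = {0} \<or> ?S = V"
  proof (rule subrep_all_trivial)
    show "subspace ?S"
      unfolding subspace_def
    proof (intro conjI ballI allI)
      show "0 \<in> ?S" by (auto intro!: exI[of _ 0])
      show "v + w \<in> ?S" if vw: "v \<in> ?S" "w \<in> ?S" for v w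
      proof -
        obtain x y x' y' where "x \<in> U" "y \<in> U" "v = x + \<rho> a y" "x' \<in> U" "y' \<in> U" "w = x' + \<rho> a y'"
          using vw by blast
        then show ?thesis
          by (simp, intro exI[of _ "x + x'"] exI[of _ "y + y'"]) (simp add: act_add algebra_simps)
      qed
      show "s c v \<in> ?S" if v: "v \<in> ?S" for c v
      proof -
        obtain x y where "x \<in> U" "y \<in> U" "v = x + \<rho> a y" using v by blast
        then show ?thesis
          by (simp, intro exI[of _ "s c x"] exI[of _ "s (cnj c) y"])
            (simp add: act_scale_a scale_right_distrib)
      qed
    qed
    show "\<rho> g v \<in> ?S" if "g \<in> even_part G \<phi>" "v \<in> ?S" for g v
      using that by (force simp: act_shift act_add even_carrier conj_even)
    show "\<rho> a v \<in> ?S" if v: "v \<in> ?S" for v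
    proof -
      obtain x y where "x \<in> U" "y \<in> U" "v = x + \<rho> a y" using v by blast
      then show ?thesis
        by (simp, intro exI[of _ "\<rho> (a \<otimes> a) y"] exI[of _ x]) (simp add: act_add add.commute)
    qed
  qed auto
  moreover have "U \<subseteq> ?S" by (force intro: exI[of _ 0])
  moreover have "U \<noteq> {0}" using irrU by (simp add: irreducible_rep_def)
  ultimately have "?S = V" by auto
  then show ?thesis using assms by blast
qed

lemma decomp_unique:
  assumes "x \<in> U" "y \<in> U" "x' \<in> U" "y' \<in> U" "x + \<rho> a y = x' + \<rho> a y'"
  shows "x = x'" "y = y'"
proof -
  have "x + s (-1) x' = \<rho> a y' + s (-1) (\<rho> a y)"
    using assms(5) by (simp add: algebra_simps)
  also have "\<dots> = \<rho> a (y' + s (-1) y)"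
    using assms by (simp only: act_add act_scale_a a_in U_V U_simps) simp
  finally have "x + s (-1) x' = \<rho> a (y' + s (-1) y)" .
  then have "x + s (-1) x' = 0" "y' + s (-1) y = 0"
    using meet_trivial[of "x + s (-1) x'" "y' + s (-1) y"] assms U_simps by blast+
  then show "x = x'" "y = y'" by simp_all
qed

text \<open>The coordinates of a vector with respect to \<open>V = U \<oplus> \<rho> a U\<close>.\<close>
definition fst_coord :: "'v \<Rightarrow> 'v" where
  "fst_coord v = (THE x. x \<in> U \<and> (\<exists>y\<in>U. v = x + \<rho> a y))"

definition snd_coord :: "'v \<Rightarrow> 'v" where
  "snd_coord v = (THE y. y \<in> U \<and> (\<exists>x\<in>U. v = x + \<rho> a y))"

lemma coord_eq:
  assumes "x \<in> U" "y \<in> U"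
  shows "fst_coord (x + \<rho> a y) = x" "snd_coord (x + \<rho> a y) = y"
proof -
  show "fst_coord (x + \<rho> a y) = x"
    unfolding fst_coord_def using assms by (intro the_equality) (blast, metis decomp_unique(1))
  show "snd_coord (x + \<rho> a y) = y"
    unfolding snd_coord_def using assms by (intro the_equality) (blast, metis decomp_unique(2))
qed

lemma coord_U:
  assumes "x \<in> U"
  shows "fst_coord x = x" "snd_coord x = 0" "fst_coord (\<rho> a x) = 0" "snd_coord (\<rho> a x) = x"
  using coord_eq[of x 0] coord_eq[of 0 x] assms by simp_all

lemma coord_sum: "v \<in> V \<Longrightarrow> fst_coord v + \<rho> a (snd_coord v) = v"
  and coord_in [simp]: "v \<in> V \<Longrightarrow> fst_coord v \<in> U" "v \<in> V \<Longrightarrow> snd_coord v \<in> U"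
  using decomp_exists[of v] by (auto simp: coord_eq)

lemma coord_add:
  assumes "v \<in> V" "w \<in> V"
  shows "fst_coord (v + w) = fst_coord v + fst_coord w"
    "snd_coord (v + w) = snd_coord v + snd_coord w"
proof -
  have "v + w = (fst_coord v + fst_coord w) + \<rho> a (snd_coord v + snd_coord w)"
    using coord_sum[OF assms(1)] coord_sum[OF assms(2)] assms
    by (simp add: act_add) (metis add.assoc add.commute)
  then show "fst_coord (v + w) = fst_coord v + fst_coord w"
    "snd_coord (v + w) = snd_coord v + snd_coord w"
    using coord_eq assms by simp_all
qed

lemma coord_scale:
  assumes "v \<in> V"
  shows "fst_coord (s z v) = s z (fst_coord v)" "snd_coord (s z v) = s (cnj z) (snd_coord v)"
proof -
  have "s z v = s z (fst_coord v) + \<rho> a (s (cnj z) (snd_coord v))"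
    using coord_sum[OF assms] assms by (simp add: act_scale_a flip: scale_right_distrib)
  then show "fst_coord (s z v) = s z (fst_coord v)" "snd_coord (s z v) = s (cnj z) (snd_coord v)"
    using coord_eq assms by simp_all
qed

lemma coord_even:
  assumes "v \<in> V" "g \<in> even_part G \<phi>"
  shows "fst_coord (\<rho> g v) = \<rho> g (fst_coord v)"
    "snd_coord (\<rho> g v) = \<rho> (inv a \<otimes> g \<otimes> a) (snd_coord v)"
proof -
  have "\<rho> g v = \<rho> g (fst_coord v) + \<rho> g (\<rho> a (snd_coord v))"
    using coord_sum[OF assms(1)] assms act_add[of g "fst_coord v" "\<rho> a (snd_coord v)"]
    by (simp add: even_carrier)
  also have "\<dots> = \<rho> g (fst_coord v) + \<rho> a (\<rho> (inv a \<otimes> g \<otimes> a) (snd_coord v))"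
    using assms by (simp add: act_shift)
  finally show "fst_coord (\<rho> g v) = \<rho> g (fst_coord v)"
    "snd_coord (\<rho> g v) = \<rho> (inv a \<otimes> g \<otimes> a) (snd_coord v)"
    using coord_eq assms conj_even by simp_all
qed

lemma coord_a:
  assumes "v \<in> V"
  shows "fst_coord (\<rho> a v) = \<rho> (a \<otimes> a) (snd_coord v)" "snd_coord (\<rho> a v) = fst_coord v"
proof -
  have "\<rho> a v = \<rho> (a \<otimes> a) (snd_coord v) + \<rho> a (fst_coord v)"
    using coord_sum[OF assms] assms act_add[of a "fst_coord v" "\<rho> a (snd_coord v)"]
    by (simp add: add.commute)
  then show "fst_coord (\<rho> a v) = \<rho> (a \<otimes> a) (snd_coord v)" "snd_coord (\<rho> a v) = fst_coord v"
    using coord_eq assms by simp_all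
qed

text \<open>
  An endomorphism is determined by its restriction to \<open>U\<close>, because it commutes with \<open>\<rho> a\<close>; and any
  \<open>G\<^sub>0\<close>-morphism \<open>U \<rightarrow> V\<close> extends by this formula.
\<close>
definition extend :: "('v \<Rightarrow> 'v) \<Rightarrow> 'v \<Rightarrow> 'v" where
  "extend S = restrict (\<lambda>v. S (fst_coord v) + \<rho> a (S (snd_coord v))) V"

lemma extend_End:
  assumes S: "linear_map s U s V S"
    and eqv: "\<And>g u. g \<in> even_part G \<phi> \<Longrightarrow> u \<in> U \<Longrightarrow> S (\<rho> g u) = \<rho> g (S u)"
  shows "extend S \<in> Hom_rep (carrier G) s V \<rho> s V \<rho>"
proof -
  note L = linear_mapD[OF S]
  let ?E = "\<lambda>v. S (fst_coord v) + \<rho> a (S (snd_coord v))"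
  have in_V: "?E v \<in> V" if "v \<in> V" for v using that L by simp
  have even: "?E (\<rho> g v) = \<rho> g (?E v)" if "g \<in> even_part G \<phi>" "v \<in> V" for g v
    using that L by (simp add: coord_even eqv act_add even_carrier act_shift conj_even)
  have odd: "?E (\<rho> a v) = \<rho> a (?E v)" if "v \<in> V" for v
    using that L by (simp add: coord_a eqv act_add add.commute)
  have "?E (\<rho> g v) = \<rho> g (?E v)" if "g \<in> carrier G" "v \<in> V" for g v
    by (rule equivariant_from_even[where T = ?E, OF in_V even odd that])
  then show ?thesis
    using in_V L
    by (auto simp: Hom_rep_def extend_def linear_map_def coord_add coord_scale act_add
        scale_right_distrib act_scale_a algebra_simps)
qed

lemma End_eq_extend:
  assumes "T \<in> Hom_rep (carrier G) s V \<rho> s V \<rho>"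
  shows "T = extend T"
proof
  fix v
  have T: "linear_map s V s V T" "T \<in> extensional V"
    "\<And>g v. g \<in> carrier G \<Longrightarrow> v \<in> V \<Longrightarrow> T (\<rho> g v) = \<rho> g (T v)"
    using assms by (auto simp: Hom_rep_def)
  show "T v = extend T v"
  proof (cases "v \<in> V")
    case True
    have "T v = T (fst_coord v + \<rho> a (snd_coord v))" using True by (simp add: coord_sum)
    then show ?thesis using True T(3) linear_mapD(2)[OF T(1)] by (simp add: extend_def)
  qed (use T in \<open>auto simp: extend_def extensional_def\<close>)
qed

lemma extend_cong: "(\<And>u. u \<in> U \<Longrightarrow> S u = S' u) \<Longrightarrow> extend S = extend S'"
  unfolding extend_def by (intro restrict_ext) simp

lemma extend_U: "linear_map s U s V S \<Longrightarrow> u \<in> U \<Longrightarrow> extend S u = S u"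
  using linear_mapD(3)[of s U s V S 0 0] by (simp add: extend_def coord_U)

lemma U_scalar:
  assumes T: "linear_map s U s U T"
    and eqv: "\<And>g u. g \<in> even_part G \<phi> \<Longrightarrow> u \<in> U \<Longrightarrow> T (\<rho> g u) = \<rho> g (T u)"
  shows "\<exists>z. \<forall>u\<in>U. T u = s z u"
proof -
  obtain B where B: "finite B" "U \<subseteq> span B" using finite_span U_V by blast
  show ?thesis
  proof (rule schur_scalar[OF vector_space_axioms B subspace_U irrU _ T eqv])
    show "linear_map s U s U (\<rho> g)" if "g \<in> even_part G \<phi>" for g
      using that by (auto simp: linear_map_def act_add act_scale_even even_carrier)
  qed
qed

section \<open>Morphisms from the constituent to its conjugate\<close>

text \<open>
  These are the \<open>G\<^sub>0\<close>-morphisms \<open>U \<rightarrow> aU\<close>, written as antilinear maps \<open>U \<rightarrow> U\<close>. Composing one with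
  \<open>\<rho> a\<close> gives a linear \<open>G\<^sub>0\<close>-morphism from \<open>U\<close> to the subspace \<open>\<rho> a U\<close> of \<open>V\<close>.
\<close>
definition conj_hom :: "('v \<Rightarrow> 'v) \<Rightarrow> bool" where
  "conj_hom f \<longleftrightarrow> antilinear_map s U s U f \<and>
     (\<forall>g\<in>even_part G \<phi>. \<forall>u\<in>U. f (\<rho> g u) = \<rho> (inv a \<otimes> g \<otimes> a) (f u))"

lemma conj_homD:
  assumes "conj_hom f"
  shows "u \<in> U \<Longrightarrow> f u \<in> U"
    and "u \<in> U \<Longrightarrow> v \<in> U \<Longrightarrow> f (u + v) = f u + f v"
    and "u \<in> U \<Longrightarrow> f (s z u) = s (cnj z) (f u)"
    and "g \<in> even_part G \<phi> \<Longrightarrow> u \<in> U \<Longrightarrow> f (\<rho> g u) = \<rho> (inv a \<otimes> g \<otimes> a) (f u)"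
  using assms by (auto simp: conj_hom_def antilinear_map_def)

lemma conj_hom_square:
  assumes "conj_hom f" "u \<in> U"
  shows "f (\<rho> (a \<otimes> a) u) = \<rho> (a \<otimes> a) (f u)"
proof -
  have "inv a \<otimes> (a \<otimes> a) \<otimes> a = a \<otimes> a" by (simp add: m_assoc[symmetric])
  then show ?thesis using conj_homD[OF assms(1)] assms(2) by simp
qed

text \<open>
  Schur's lemma for \<open>U\<close> and \<open>aU\<close>. The conjugate \<open>aU\<close> is irreducible because conjugation by \<open>a\<close>
  permutes \<open>G\<^sub>0\<close>, so that \<open>U\<close> and \<open>aU\<close> have the same invariant subspaces.
\<close>
lemma nonzero_conj_hom_iff:
  "iso_to_conj G \<phi> a s U \<rho> \<longleftrightarrow> (\<exists>f. conj_hom f \<and> (\<exists>u\<in>U. f u \<noteq> 0))"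
proof
  assume "iso_to_conj G \<phi> a s U \<rho>"
  then obtain f S where f: "f \<in> Hom_rep (even_part G \<phi>) s U \<rho> (conj_scale s) U (conj_act G a \<rho>)"
    and S: "S \<in> Hom_rep (even_part G \<phi>) (conj_scale s) U (conj_act G a \<rho>) s U \<rho>"
      "\<forall>u\<in>U. S (f u) = u"
    unfolding iso_to_conj_def iso_rep_def is_iso_rep_def by blast
  have S0: "S 0 = 0"
    using linear_mapD(3)[of "conj_scale s" U s U S 0 0] S(1) by (auto simp: Hom_rep_def conj_scale_def)
  have "conj_hom f"
    using f by (auto simp: Hom_rep_def conj_hom_def linear_map_def antilinear_map_def
        conj_scale_def conj_act_def)
  moreover obtain u where "u \<in> U" "u \<noteq> 0"
    using irrU U_simps(1) unfolding irreducible_rep_def by blast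
  ultimately show "\<exists>f. conj_hom f \<and> (\<exists>u\<in>U. f u \<noteq> 0)" using S S0 by metis
next
  assume "\<exists>f. conj_hom f \<and> (\<exists>u\<in>U. f u \<noteq> 0)"
  then obtain f u where f: "conj_hom f" and u: "u \<in> U" "f u \<noteq> 0" by blast
  note F = conj_homD[OF f]
  have vs: "vector_space (conj_scale s)"
    by unfold_locales (simp_all add: conj_scale_def scale_right_distrib scale_left_distrib)
  interpret c: vector_space "conj_scale s" by (rule vs)
  have sub: "c.subspace S \<longleftrightarrow> subspace S" for S
    unfolding c.subspace_def subspace_def conj_scale_def by (metis complex_cnj_cnj)
  have inv: "\<rho> g x \<in> S"
    if "\<forall>g\<in>even_part G \<phi>. \<forall>x\<in>S. conj_act G a \<rho> g x \<in> S" "g \<in> even_part G \<phi>" "x \<in> S" for g x S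
  proof -
    have "inv a \<otimes> (a \<otimes> g \<otimes> inv a) \<otimes> a = g"
      using even_carrier[OF that(2)] by (simp add: m_assoc)
    then show ?thesis using that conj_even(2)[OF that(2)] unfolding conj_act_def by metis
  qed
  have irr: "irreducible_rep (even_part G \<phi>) (conj_scale s) U (conj_act G a \<rho>)"
    using irrU inv unfolding irreducible_rep_def subrep_def sub by blast
  have hom: "restrict f U \<in> Hom_rep (even_part G \<phi>) s U \<rho> (conj_scale s) U (conj_act G a \<rho>)"
    using F by (auto simp: Hom_rep_def linear_map_def conj_scale_def conj_act_def)
  have "(\<forall>u\<in>U. restrict f U u = 0) \<or> is_iso_rep (even_part G \<phi>) s U \<rho>
      (conj_scale s) U (conj_act G a \<rho>) (restrict f U)"
    by (rule schur_zero_or_iso[OF vector_space_axioms vs subspace_U _ _ _ irrU irr hom])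
      (simp_all add: sub subspace_U conj_act_def even_carrier conj_even)
  then show "iso_to_conj G \<phi> a s U \<rho>"
    unfolding iso_to_conj_def iso_rep_def using u by auto
qed

text \<open>The composite \<open>U \<rightarrow> aU \<rightarrow> a(aU) \<cong> U\<close> is linear and \<open>G\<^sub>0\<close>-equivariant, hence a scalar.\<close>
lemma conj_hom_comp_scalar:
  assumes f: "conj_hom f" and h: "conj_hom h"
  shows "\<exists>z. \<forall>u\<in>U. \<rho> (a \<otimes> a) (f (h u)) = s z u"
proof (rule U_scalar)
  note F = conj_homD[OF f] and H = conj_homD[OF h]
  show "linear_map s U s U (\<lambda>u. \<rho> (a \<otimes> a) (f (h u)))"
    by (auto simp: linear_map_def F H act_add act_scale_even)
  show "\<rho> (a \<otimes> a) (f (h (\<rho> g u))) = \<rho> g (\<rho> (a \<otimes> a) (f (h u)))"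
    if g: "g \<in> even_part G \<phi>" and u: "u \<in> U" for g u
  proof -
    have gc: "g \<in> carrier G" using g by (rule even_carrier)
    have "(a \<otimes> a) \<otimes> (inv a \<otimes> (inv a \<otimes> g \<otimes> a) \<otimes> a) = g \<otimes> (a \<otimes> a)"
      using gc by (simp add: m_assoc)
    then show ?thesis
      using g u gc by (simp add: F H conj_even flip: act_mult)
  qed
qed

section \<open>Endomorphisms as pairs of complex numbers\<close>

text \<open>
  With a fixed \<open>f : U \<rightarrow> aU\<close>, the \<open>G\<^sub>0\<close>-morphisms from \<open>U\<close> to \<open>U \<oplus> \<rho> a U\<close> are
  \<open>u \<mapsto> z u + w (\<rho> a (f u))\<close>. Taking \<open>f = 0\<close> covers the case where \<open>U\<close> and \<open>aU\<close> are not isomorphic.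
\<close>
definition emb :: "('v \<Rightarrow> 'v) \<Rightarrow> complex \<Rightarrow> complex \<Rightarrow> 'v \<Rightarrow> 'v" where
  "emb f z w = extend (\<lambda>u. s z u + s w (\<rho> a (f u)))"

lemma emb_linear:
  assumes "conj_hom f"
  shows "linear_map s U s V (\<lambda>u. s z u + s w (\<rho> a (f u)))"
  using conj_homD[OF assms]
  by (auto simp: linear_map_def act_add act_scale_a scale_right_distrib algebra_simps)

lemma emb_End:
  assumes f: "conj_hom f"
  shows "emb f z w \<in> Hom_rep (carrier G) s V \<rho> s V \<rho>"
  unfolding emb_def
proof (rule extend_End[OF emb_linear[OF f]])
  show "s z (\<rho> g u) + s w (\<rho> a (f (\<rho> g u))) = \<rho> g (s z u + s w (\<rho> a (f u)))"
    if "g \<in> even_part G \<phi>" "u \<in> U" for g u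
    using that conj_homD[OF f] by (simp add: act_add even_carrier act_scale_even act_shift)
qed

lemma emb_U: "conj_hom f \<Longrightarrow> u \<in> U \<Longrightarrow> emb f z w u = s z u + s w (\<rho> a (f u))"
  unfolding emb_def using extend_U[OF emb_linear] by simp

lemma emb_add:
  assumes "conj_hom f" "v \<in> V"
  shows "emb f (z + z') (w + w') v = emb f z w v + emb f z' w' v"
  using assms conj_homD[OF assms(1)]
  by (simp add: emb_def extend_def scale_left_distrib act_add algebra_simps)

lemma emb_real_scale:
  assumes "conj_hom f" "v \<in> V"
  shows "emb f (of_real r * z) (of_real r * w) v = s (of_real r) (emb f z w v)"
  using assms conj_homD[OF assms(1)] act_scale_a[of _ "of_real r"]
  by (simp add: emb_def extend_def scale_right_distrib act_add flip: scale_scale)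

lemma emb_one: "conj_hom f \<Longrightarrow> v \<in> V \<Longrightarrow> emb f 1 0 v = v"
  using coord_sum by (simp add: emb_def extend_def)

text \<open>
  Both sides are endomorphisms, so it is enough to compare them on \<open>U\<close>. There the conjugates come
  from the antilinear maps \<open>\<rho> a\<close> and \<open>f\<close>, and \<open>l\<close> from applying \<open>\<rho> a \<circ> f\<close> twice.
\<close>
lemma emb_mult:
  assumes f: "conj_hom f" and l: "\<And>u. u \<in> U \<Longrightarrow> \<rho> (a \<otimes> a) (f (f u)) = s l u" and v: "v \<in> V"
  shows "emb f z w (emb f z' w' v) = emb f (z * z' + l * w' * cnj w) (z' * w + w' * cnj z) v"
proof -
  note F = conj_homD[OF f]
  let ?L = "restrict (\<lambda>v. emb f z w (emb f z' w' v)) V"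
  let ?R = "emb f (z * z' + l * w' * cnj w) (z' * w + w' * cnj z)"
  have E: "linear_map s V s V (emb f z w)"
    "\<And>g v. g \<in> carrier G \<Longrightarrow> v \<in> V \<Longrightarrow> emb f z w (\<rho> g v) = \<rho> g (emb f z w v)" for z w
    using emb_End[OF f, of z w] by (auto simp: Hom_rep_def)
  note L = linear_mapD[OF E(1)]
  have "?L \<in> Hom_rep (carrier G) s V \<rho> s V \<rho>"
    by (auto simp: Hom_rep_def linear_map_def L E(2))
  then have "?L = extend ?L" by (rule End_eq_extend)
  also have "\<dots> = extend ?R"
  proof (rule extend_cong)
    fix u assume u: "u \<in> U"
    have "?L u = emb f z w (s z' u + s w' (\<rho> a (f u)))" using u by (simp add: emb_U f)
    also have "\<dots> = s z' (emb f z w u) + s w' (\<rho> a (emb f z w (f u)))"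
      using u F by (simp add: L E(2))
    also have "\<dots> = s z' (s z u + s w (\<rho> a (f u))) + s w' (\<rho> a (s z (f u) + s w (\<rho> a (f (f u)))))"
      using u F by (simp add: emb_U f)
    also have "\<dots> = s z' (s z u + s w (\<rho> a (f u))) + s w' (s (cnj z) (\<rho> a (f u)) + s (cnj w) (s l u))"
      using u F by (simp add: act_add act_scale_a l)
    also have "\<dots> = ?R u"
      using u F by (simp add: emb_U f scale_right_distrib scale_left_distrib algebra_simps)
    finally show "?L u = ?R u" .
  qed
  also have "\<dots> = ?R" using End_eq_extend[OF emb_End[OF f]] by simp
  finally show ?thesis using v by (metis restrict_apply')
qed

text \<open>
  The component of \<open>T\<close> along \<open>U\<close> is a \<open>G\<^sub>0\<close>-endomorphism of \<open>U\<close>, hence a scalar; the component along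
  \<open>\<rho> a U\<close> is a morphism \<open>U \<rightarrow> aU\<close>.
\<close>
lemma End_components:
  assumes T: "T \<in> Hom_rep (carrier G) s V \<rho> s V \<rho>"
  obtains z h where "conj_hom h" "\<And>u. u \<in> U \<Longrightarrow> T u = s z u + \<rho> a (h u)"
proof -
  have lin: "linear_map s V s V T"
    and eqv: "\<And>g v. g \<in> carrier G \<Longrightarrow> v \<in> V \<Longrightarrow> T (\<rho> g v) = \<rho> g (T v)"
    using T by (auto simp: Hom_rep_def)
  note L = linear_mapD[OF lin]
  have "\<exists>z. \<forall>u\<in>U. fst_coord (T u) = s z u"
    by (rule U_scalar) (auto simp: linear_map_def L coord_add coord_scale eqv coord_even even_carrier)
  then obtain z where z: "\<And>u. u \<in> U \<Longrightarrow> fst_coord (T u) = s z u" by blast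
  have "conj_hom (\<lambda>u. snd_coord (T u))"
    by (auto simp: conj_hom_def antilinear_map_def L coord_add coord_scale eqv coord_even even_carrier)
  moreover have "T u = s z u + \<rho> a (snd_coord (T u))" if "u \<in> U" for u
    using coord_sum[of "T u"] z that L by simp
  ultimately show ?thesis using that by blast
qed

lemma End_eq_emb:
  assumes T: "T \<in> Hom_rep (carrier G) s V \<rho> s V \<rho>" and f: "conj_hom f"
    and "\<And>u. u \<in> U \<Longrightarrow> T u = s z u + s w (\<rho> a (f u))"
  shows "T = emb f z w"
  using End_eq_extend[OF T] extend_cong[of T "\<lambda>u. s z u + s w (\<rho> a (f u))"] assms(3)
  by (simp add: emb_def)

lemma emb_inject:
  assumes f: "conj_hom f" and eq: "emb f z w = emb f z' w'" and u: "u \<in> U" "u \<noteq> 0"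
  shows "z = z'" and "f u \<noteq> 0 \<Longrightarrow> w = w'"
proof -
  note F = conj_homD[OF f]
  have "s z u + \<rho> a (s (cnj w) (f u)) = s z' u + \<rho> a (s (cnj w') (f u))"
    using fun_cong[OF eq, of u] emb_U[OF f u(1)] u F by (simp add: act_scale_a)
  then have "s z u = s z' u" "s (cnj w) (f u) = s (cnj w') (f u)"
    using decomp_unique[of "s z u" "s (cnj w) (f u)" "s z' u" "s (cnj w') (f u)"] u F by auto
  then show "z = z'" "f u \<noteq> 0 \<Longrightarrow> w = w'" using u by auto
qed

lemma U_nonzero: "\<exists>u\<in>U. u \<noteq> 0"
  using irrU U_simps(1) unfolding irreducible_rep_def by blast

section \<open>The complex case\<close>

text \<open>No nonzero \<open>U \<rightarrow> aU\<close> exists, so every endomorphism preserves \<open>U\<close> and is a scalar there.\<close>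
lemma End_complex:
  assumes "\<not> iso_to_conj G \<phi> a s U \<rho>"
  shows "End_isomorphic (carrier G) s V \<rho> TYPE(complex)"
proof -
  let ?o = "\<lambda>_ :: 'v. 0 :: 'v"
  have f: "conj_hom ?o"
    by (auto simp: conj_hom_def antilinear_map_def conj_even even_carrier)
  have l: "\<rho> (a \<otimes> a) (?o (?o u)) = s 0 u" for u by simp
  obtain u where u: "u \<in> U" "u \<noteq> 0" using U_nonzero by blast
  have "inj (\<lambda>z. emb ?o z 0)" using emb_inject(1)[OF f _ u] by (blast intro: injI)
  moreover have "T \<in> range (\<lambda>z. emb ?o z 0)" if T: "T \<in> Hom_rep (carrier G) s V \<rho> s V \<rho>" for T
  proof -
    obtain z h where h: "conj_hom h" "\<And>u. u \<in> U \<Longrightarrow> T u = s z u + \<rho> a (h u)"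
      using End_components[OF T] by blast
    have "h u = 0" if "u \<in> U" for u using assms nonzero_conj_hom_iff h that by blast
    then have "T = emb ?o z 0" using h by (intro End_eq_emb[OF T f]) simp
    then show ?thesis by simp
  qed
  ultimately have "bij_betw (\<lambda>z. emb ?o z 0) UNIV (Hom_rep (carrier G) s V \<rho> s V \<rho>)"
    using emb_End[OF f] unfolding bij_betw_def by blast
  then show ?thesis
    unfolding End_isomorphic_def
    using emb_one[OF f] emb_add[OF f, of _ _ _ 0 0] emb_mult[OF f l, of _ _ 0 _ 0]
      emb_real_scale[OF f, of _ _ _ 0]
    by (intro exI[of _ "\<lambda>z. emb ?o z 0"]) (auto simp: scaleR_conv_of_real)
qed

section \<open>The quaternionic case\<close>

text \<open>
  The square of \<open>J = \<rho> a \<circ> f\<close> on \<open>U\<close> is a scalar \<open>l\<close>, real because \<open>J\<^sup>2\<close> commutes on \<open>U\<close>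
  with the antilinear \<open>f\<close>. If \<open>l = r\<^sup>2\<close> with \<open>r\<close> real, then \<open>J\<close>, extended to \<open>V\<close>, has eigenvalue \<open>r\<close>; the
  eigenspace is a subrepresentation, so \<open>J = r\<close>. This is impossible as \<open>J\<close> maps \<open>U\<close> into
  \<open>\<rho> a U\<close>. Hence \<open>l < 0\<close>, and rescaling \<open>f\<close> gives \<open>l = - 1\<close>.
\<close>
lemma conj_hom_normalised:
  assumes f: "conj_hom f" and u: "u \<in> U" "f u \<noteq> 0"
  obtains f' where "conj_hom f'" "\<And>u. u \<in> U \<Longrightarrow> \<rho> (a \<otimes> a) (f' (f' u)) = s (- 1) u"
proof -
  note F = conj_homD[OF f]
  obtain l where l: "\<And>u. u \<in> U \<Longrightarrow> \<rho> (a \<otimes> a) (f (f u)) = s l u"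
    using conj_hom_comp_scalar[OF f f] by blast
  have "s (cnj l) (f u) = f (\<rho> (a \<otimes> a) (f (f u)))" using u F l by simp
  also have "\<dots> = s l (f u)"
    using conj_hom_square[OF f, of "f (f u)"] F(1) u l[of "f u"] by simp
  finally have "cnj l = l" using u by simp
  then obtain t where t: "l = of_real t" by (metis Reals_cnj_iff Reals_cases)
  have "t < 0"
  proof (rule ccontr)
    assume "\<not> t < 0"
    define r :: complex where "r = of_real (sqrt t)"
    have r: "r * r = l" "cnj r = r" using \<open>\<not> t < 0\<close> t by (simp_all add: r_def flip: of_real_mult)
    define J where "J = emb f 0 1"
    have J: "linear_map s V s V J"
      "\<And>g v. g \<in> carrier G \<Longrightarrow> v \<in> V \<Longrightarrow> J (\<rho> g v) = \<rho> g (J v)"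
      using emb_End[OF f, of 0 1] by (auto simp: J_def Hom_rep_def)
    note L = linear_mapD[OF J(1)]
    have JU: "J u = \<rho> a (f u)" if "u \<in> U" for u using that by (simp add: J_def emb_U f)
    have J0: "J 0 = 0" using L(3)[of 0 0] by simp
    let ?S = "{v \<in> V. J v = s r v}"
    have "?S = {0} \<or> ?S = V"
      by (rule subrep_all_trivial)
        (auto simp: subspace_def L J(2) J0 scale_right_distrib mult.commute act_scale_even
          act_scale_a r even_carrier)
    moreover have "s r u + \<rho> a (f u) \<in> ?S"
      using u F by (simp add: L J(2) JU l scale_right_distrib act_scale_a r add.commute)
    moreover have "s r u + \<rho> a (f u) \<noteq> 0"
      using decomp_unique(2)[of "s r u" "f u" 0 0] u F by auto
    moreover have "u \<notin> ?S"
      using decomp_unique(2)[of 0 "f u" "s r u" 0] u F by (auto simp: JU)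
    ultimately show False using U_V[OF u(1)] by (metis (no_types, lifting) singletonD)
  qed
  define c :: complex where "c = of_real (1 / sqrt (- t))"
  have "(1 / sqrt (- t)) * (1 / sqrt (- t)) * t = - 1" using \<open>t < 0\<close> by (simp add: field_simps)
  moreover have "c * c * l = of_real ((1 / sqrt (- t)) * (1 / sqrt (- t)) * t)"
    by (simp only: c_def t of_real_mult)
  ultimately have c: "c * c * l = - 1" "cnj c = c" by (simp_all add: c_def)
  show ?thesis
  proof (rule that[of "\<lambda>u. s c (f u)"])
    show "conj_hom (\<lambda>u. s c (f u))"
      unfolding conj_hom_def antilinear_map_def
      by (auto simp: F scale_right_distrib mult.commute act_scale_even conj_even)
    show "\<rho> (a \<otimes> a) (s c (f (s c (f u)))) = s (- 1) u" if "u \<in> U" for u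
      using that c by (simp add: F act_scale_even l del: scale_minus_left)
  qed
qed

lemma End_quaternion:
  assumes "iso_to_conj G \<phi> a s U \<rho>"
  shows "End_isomorphic (carrier G) s V \<rho> TYPE(quat)"
proof -
  obtain f where f: "conj_hom f" and l: "\<And>u. u \<in> U \<Longrightarrow> \<rho> (a \<otimes> a) (f (f u)) = s (- 1) u"
    using assms nonzero_conj_hom_iff conj_hom_normalised by metis
  note F = conj_homD[OF f]
  obtain u where u: "u \<in> U" "u \<noteq> 0" using U_nonzero by blast
  have fu: "f u \<noteq> 0"
  proof
    assume "f u = 0"
    moreover have "f 0 = 0" using F(3)[of 0 0] by simp
    ultimately show False using l[OF u(1)] u by simp
  qed
  \<comment> \<open>The endomorphism \<open>i\<close> multiplies by \<open>\<i>\<close> on \<open>U\<close> and by \<open>- \<i>\<close> on \<open>\<rho> a U\<close>, and \<open>j\<close> is \<open>\<rho> a \<circ> f\<close> on \<open>U\<close>.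
    So \<open>k = ij\<close> is \<open>- \<i> (\<rho> a \<circ> f)\<close> on \<open>U\<close>, which explains the sign.\<close>
  define F where "F q = emb f (Complex (qRe q) (qI q)) (Complex (qJ q) (- qK q))" for q
  have mult: "emb f z w (emb f z' w' v) =
      emb f (z * z' + (- 1) * w' * cnj w) (z' * w + w' * cnj z) v" if "v \<in> V" for z w z' w' v
    by (rule emb_mult[OF f _ that]) (rule l)
  have "inj F"
  proof (rule injI)
    fix p q assume "F p = F q"
    then show "p = q"
      unfolding F_def using emb_inject[OF f _ u] fu by (metis complex.inject neg_equal_iff_equal quat.expand)
  qed
  moreover have "T \<in> range F" if T: "T \<in> Hom_rep (carrier G) s V \<rho> s V \<rho>" for T
  proof -
    obtain z h where h: "conj_hom h" "\<And>u. u \<in> U \<Longrightarrow> T u = s z u + \<rho> a (h u)"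
      using End_components[OF T] by blast
    note H = conj_homD[OF h(1)]
    obtain k where k: "\<And>u. u \<in> U \<Longrightarrow> \<rho> (a \<otimes> a) (f (h u)) = s k u"
      using conj_hom_comp_scalar[OF f h(1)] by blast
    have "h u = s (- cnj k) (f u)" if u: "u \<in> U" for u
    proof -
      have "s (cnj k) (f u) = f (\<rho> (a \<otimes> a) (f (h u)))" using u F k by simp
      also have "\<dots> = s (- 1) (h u)" using conj_hom_square[OF f] F H u l by simp
      finally show ?thesis by simp
    qed
    then have "T = emb f z (- k)"
      using h F by (intro End_eq_emb[OF T f]) (simp add: act_scale_a del: scale_minus_left)
    also have "\<dots> = F (Quat (Re z) (Im z) (Re (- k)) (- Im (- k)))" by (simp only: F_def quat.sel complex_surj minus_minus)
    finally show ?thesis by blast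
  qed
  ultimately have "bij_betw F UNIV (Hom_rep (carrier G) s V \<rho> s V \<rho>)"
    using emb_End[OF f] unfolding bij_betw_def F_def by blast
  moreover have "F 1 v = v" if "v \<in> V" for v
    using emb_one[OF f that] by (simp add: F_def one_quat_def flip: zero_complex.code one_complex.code)
  moreover have "F (x + y) v = F x v + F y v" if "v \<in> V" for x y v
    unfolding F_def emb_add[OF f that, symmetric]
    by (intro arg_cong2[where f = "\<lambda>z w. emb f z w v"]) (simp_all add: plus_quat_def complex_eq_iff)
  moreover have "F (x * y) v = F x (F y v)" if "v \<in> V" for x y v
    unfolding F_def mult[OF that]
    by (intro arg_cong2[where f = "\<lambda>z w. emb f z w v"])
      (simp_all add: times_quat_def complex_eq_iff algebra_simps)
  moreover have "F (r *\<^sub>R x) v = s (of_real r) (F x v)" if "v \<in> V" for r x v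
    unfolding F_def emb_real_scale[OF f that, symmetric]
    by (intro arg_cong2[where f = "\<lambda>z w. emb f z w v"]) (simp_all add: scaleR_quat_def complex_eq_iff)
  ultimately show ?thesis unfolding End_isomorphic_def by blast
qed

end

theorem mainTheorem1:
  fixes G :: "('g, 'm) monoid_scheme" and \<phi> :: "'g \<Rightarrow> int" and a :: 'g
    and s :: "complex \<Rightarrow> 'v::ab_group_add \<Rightarrow> 'v" and V :: "'v set" and \<rho> :: "'g \<Rightarrow> 'v \<Rightarrow> 'v"
    and t :: "complex \<Rightarrow> 'w::ab_group_add \<Rightarrow> 'w" and W :: "'w set" and \<sigma> :: "'g \<Rightarrow> 'w \<Rightarrow> 'w"
  assumes "magnetic_group G \<phi>" and "finite (carrier G)"
    and "magnetic_rep G \<phi> s V \<rho>" and "irreducible_rep (carrier G) s V \<rho>"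
    and "magnetic_rep G \<phi> t W \<sigma>" and "irreducible_rep (carrier G) t W \<sigma>"
    and "a \<in> carrier G - even_part G \<phi>"
  shows "(\<forall>T \<in> Hom_rep (carrier G) s V \<rho> t W \<sigma>.
            (\<forall>v\<in>V. T v = 0) \<or> is_iso_rep (carrier G) s V \<rho> t W \<sigma> T) \<and>
         (irreducible_rep (even_part G \<phi>) s V \<rho> \<longrightarrow>
            End_isomorphic (carrier G) s V \<rho> TYPE(real)) \<and>
         (\<not> irreducible_rep (even_part G \<phi>) s V \<rho> \<longrightarrow>
            (\<forall>U. subrep (even_part G \<phi>) s V \<rho> U \<and> irreducible_rep (even_part G \<phi>) s U \<rho> \<longrightarrow>
               (\<not> iso_to_conj G \<phi> a s U \<rho> \<longrightarrow>
                  End_isomorphic (carrier G) s V \<rho> TYPE(complex)) \<and>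
               (iso_to_conj G \<phi> a s U \<rho> \<longrightarrow>
                  End_isomorphic (carrier G) s V \<rho> TYPE(quat))))"
proof -
  have G: "magnetic_rep_space G \<phi> s V \<rho> a"
    using assms by (auto simp: magnetic_rep_space_def magnetic_rep_space_axioms_def
        magnetic_rep_def fd_cspace_def)
  have H: "magnetic_rep_space G \<phi> t W \<sigma> a"
    using assms by (auto simp: magnetic_rep_space_def magnetic_rep_space_axioms_def
        magnetic_rep_def fd_cspace_def)
  interpret V: magnetic_rep_space G \<phi> s V \<rho> a by (rule G)
  interpret W: magnetic_rep_space G \<phi> t W \<sigma> a by (rule H)
  have schur: "(\<forall>v\<in>V. T v = 0) \<or> is_iso_rep (carrier G) s V \<rho> t W \<sigma> T"
    if "T \<in> Hom_rep (carrier G) s V \<rho> t W \<sigma>" for T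
    by (rule schur_zero_or_iso[OF V.vector_space_axioms W.vector_space_axioms V.subspace_V
          W.subspace_V V.act_in W.act_zero assms(4,6) that])
  have split: "split_magnetic_rep G \<phi> s V \<rho> a U"
    if "\<not> irreducible_rep (even_part G \<phi>) s V \<rho>"
      "subrep (even_part G \<phi>) s V \<rho> U \<and> irreducible_rep (even_part G \<phi>) s U \<rho>" for U
    using G that assms(4) by (simp add: split_magnetic_rep_def split_magnetic_rep_axioms_def)
  show ?thesis
    by (intro conjI ballI impI allI)
      (fact schur V.End_irreducible_restriction
        split_magnetic_rep.End_complex[OF split] split_magnetic_rep.End_quaternion[OF split])+
qed

end
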